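(* If $G$ is a randomly $k$-dimensional graph of order $n$, then $k\leq 3$ or $k\geq n-1$.
   Context: All graphs are finite, simple and connected. For an ordered set $W=\{w_1,\dots,w_k\}\subseteq V(G)$ and $v\in V(G)$, $r(v|W)=(d(v,w_1),\dots,d(v,w_k))$, where $d$ denotes graph distance. $W$ is a resolving set if distinct vertices have distinct representations with respect to $W$; a basis is a minimum-size resolving set and its size is the metric dimension $\beta(G)$. $G$ is randomly $k$-dimensional if $\beta(G)=k$ and every $k$-subset of $V(G)$ is a basis of $G$. *)

theory Defs
  imports "Graph_Theory.Graph_Theory"
begin

text \<open>Finite simple graphs are the loop-free, symmetric digraphs without parallel arcs of the locale
  \<open>graph\<close>. The graph distance is the shortest-path cost for unit arc weights.\<close>

definition graph_dist :: "('a, 'b) pre_digraph \<Rightarrow> 'a \<Rightarrow> 'a \<Rightarrow> ereal" where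
  "graph_dist G u v = wf_digraph.\<mu> G (\<lambda>_. 1) u v"

lemma (in wf_digraph) graph_dist_eq_INF_length:
  "graph_dist G u v = (INF p\<in>{p. awalk u p v}. ereal (real (length p)))"
proof -
  have "awalk_cost (\<lambda>_. 1) p = real (length p)" for p :: "'b awalk"
    by (induct p) auto
  then show ?thesis
    by (simp add: graph_dist_def \<mu>_def)
qed

definition metric_rep :: "('a, 'b) pre_digraph \<Rightarrow> 'a \<Rightarrow> 'a list \<Rightarrow> ereal list" where
  "metric_rep G v ws = map (graph_dist G v) ws"

text \<open>The ordering \<open>ws\<close> of \<open>W\<close> is immaterial: a permutation of \<open>ws\<close> permutes all representations
  alike.\<close>

definition resolving_set :: "('a, 'b) pre_digraph \<Rightarrow> 'a set \<Rightarrow> bool" where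
  "resolving_set G W \<longleftrightarrow> W \<subseteq> verts G \<and>
    (\<exists>ws. distinct ws \<and> set ws = W \<and> inj_on (\<lambda>v. metric_rep G v ws) (verts G))"

definition metric_basis :: "('a, 'b) pre_digraph \<Rightarrow> 'a set \<Rightarrow> bool" where
  "metric_basis G W \<longleftrightarrow> is_arg_min card (resolving_set G) W"

definition metric_dimension :: "('a, 'b) pre_digraph \<Rightarrow> nat" where
  "metric_dimension G = (LEAST k. \<exists>W. resolving_set G W \<and> card W = k)"

definition randomly_dimensional :: "nat \<Rightarrow> ('a, 'b) pre_digraph \<Rightarrow> bool" where
  "randomly_dimensional k G \<longleftrightarrow>
    metric_dimension G = k \<and> (\<forall>W \<subseteq> verts G. card W = k \<longrightarrow> metric_basis G W)"

end

theory Submission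
  imports Defs "HOL-Library.Ramsey"
begin

text \<open>A set of vertices resolves the graph unless all its members are equidistant from both ends of
  some pair of distinct vertices. If every \<open>k\<close>-set resolves, then fewer than \<open>k\<close> vertices are
  equidistant from a given pair; if no \<open>(k - 1)\<close>-set resolves, then each \<open>(k - 1)\<close>-set is
  equidistant from some pair, hence is the full set of vertices equidistant from it. So there are
  at most as many \<open>(k - 1)\<close>-sets as pairs, which fails for \<open>3 \<le> k - 1 \<le> n - 3\<close>.\<close>

lemma binomial_less_binomial:
  fixes i j n :: nat
  assumes "i < j" "i + j < n"
  shows "n choose i < n choose j"
proof (cases "2 * j \<le> n")
  case True
  with \<open>i < j\<close> show ?thesis
    by (intro binomial_strict_mono) auto
next
  case False
  have "n choose i = n choose (n - i)"
    using assms by (intro binomial_symmetric) simp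
  also have "\<dots> < n choose j"
    using assms False by (intro binomial_strict_antimono) auto
  finally show ?thesis .
qed

lemma binomial_le_card_cover:
  fixes V :: "'a set" and F :: "'a set set" and j :: nat
  assumes "finite F"
    and small: "\<And>A. A \<in> F \<Longrightarrow> finite A \<and> card A \<le> j"
    and cover: "\<And>S. S \<in> [V]\<^bsup>j\<^esup> \<Longrightarrow> \<exists>A\<in>F. S \<subseteq> A"
  shows "card V choose j \<le> card F"
proof -
  have "[V]\<^bsup>j\<^esup> \<subseteq> F"
  proof
    fix S assume S: "S \<in> [V]\<^bsup>j\<^esup>"
    then obtain A where A: "A \<in> F" "S \<subseteq> A"
      using cover by blast
    with S small have "S = A"
      by (intro card_seteq) (auto simp: nsets_def)
    with A(1) show "S \<in> F" by simp
  qed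
  then have "card ([V]\<^bsup>j\<^esup>) \<le> card F"
    using \<open>finite F\<close> by (rule card_mono[rotated])
  then show ?thesis by simp
qed

definition equidistant_verts :: "('a, 'b) pre_digraph \<Rightarrow> 'a set \<Rightarrow> 'a set" where
  "equidistant_verts G P =
    {w \<in> verts G. \<forall>x\<in>P. \<forall>y\<in>P. graph_dist G x w = graph_dist G y w}"

lemma resolving_set_iff:
  "resolving_set G W \<longleftrightarrow>
    finite W \<and> W \<subseteq> verts G \<and> (\<forall>P\<in>[verts G]\<^bsup>2\<^esup>. \<not> W \<subseteq> equidistant_verts G P)"
proof -
  have "inj_on (\<lambda>v. metric_rep G v ws) (verts G) \<longleftrightarrow>
      (\<forall>P\<in>[verts G]\<^bsup>2\<^esup>. \<not> set ws \<subseteq> equidistant_verts G P)"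
    if "set ws \<subseteq> verts G" for ws
    using that
    by (auto simp: inj_on_def metric_rep_def equidistant_verts_def nsets_2_eq subset_iff)
  then show ?thesis
    unfolding resolving_set_def by (metis finite_distinct_list finite_set)
qed

lemma card_less_metric_dimension_not_resolving:
  assumes "card W < metric_dimension G"
  shows "\<not> resolving_set G W"
  using assms not_less_Least unfolding metric_dimension_def by blast

lemma randomly_dimensional_card_equidistant_less:
  assumes "randomly_dimensional k G" "P \<in> [verts G]\<^bsup>2\<^esup>"
  shows "card (equidistant_verts G P) < k"
proof (rule ccontr)
  assume "\<not> card (equidistant_verts G P) < k"
  then obtain W where W: "W \<subseteq> equidistant_verts G P" "card W = k"
    by (meson not_less obtain_subset_with_card_n)
  then have "W \<subseteq> verts G"
    by (auto simp: equidistant_verts_def)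
  with assms(1) W(2) have "resolving_set G W"
    by (simp add: randomly_dimensional_def metric_basis_def is_arg_min_def)
  with W(1) assms(2) show False
    by (simp add: resolving_set_iff)
qed

lemma randomly_dimensional_binomial_le:
  assumes fin: "finite (verts G)" and randomly: "randomly_dimensional k G" and "0 < k"
  shows "card (verts G) choose (k - 1) \<le> card (verts G) choose 2"
proof -
  let ?pairs = "[verts G]\<^bsup>2\<^esup>"
  have "card (verts G) choose (k - 1) \<le> card (equidistant_verts G ` ?pairs)"
  proof (rule binomial_le_card_cover)
    show "finite (equidistant_verts G ` ?pairs)"
      using fin by (simp add: finite_imp_finite_nsets)
    show "finite A \<and> card A \<le> k - 1" if "A \<in> equidistant_verts G ` ?pairs" for A
      using that fin randomly_dimensional_card_equidistant_less[OF randomly]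
      by (fastforce simp: equidistant_verts_def)
    show "\<exists>A\<in>equidistant_verts G ` ?pairs. S \<subseteq> A" if S: "S \<in> [verts G]\<^bsup>(k - 1)\<^esup>" for S
    proof -
      have "card S < metric_dimension G"
        using randomly \<open>0 < k\<close> S by (simp add: randomly_dimensional_def nsets_def)
      then have "\<not> resolving_set G S"
        by (rule card_less_metric_dimension_not_resolving)
      with S show ?thesis
        by (simp add: resolving_set_iff nsets_def)
    qed
  qed
  also have "\<dots> \<le> card ?pairs"
    using fin by (intro card_image_le finite_imp_finite_nsets)
  finally show ?thesis by simp
qed

theorem mainTheorem4:
  fixes G :: "('a, 'b) pre_digraph" and k n :: nat
  assumes "graph G"
    and "Digraph_Component.connected G"
    and "card (verts G) = n"
    and "randomly_dimensional k G"
  shows "k \<le> 3 \<or> k \<ge> n - 1"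
proof (rule ccontr)
  assume "\<not> (k \<le> 3 \<or> k \<ge> n - 1)"
  then have "0 < k" "2 < k - 1" "2 + (k - 1) < n" by auto
  interpret graph G by fact
  have "n choose (k - 1) \<le> n choose 2"
    using randomly_dimensional_binomial_le[OF finite_verts assms(4) \<open>0 < k\<close>] assms(3) by simp
  moreover have "n choose 2 < n choose (k - 1)"
    using \<open>2 < k - 1\<close> \<open>2 + (k - 1) < n\<close> by (rule binomial_less_binomial)
  ultimately show False by simp
qed

end
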